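(* The symmetric bilinear form $\langle\,,\,\rangle$ on $V$ is nondegenerate and satisfies $$\langle\beta\xi,\zeta\rangle=\langle\xi,\beta^\dagger\zeta\rangle\qquad\text{for all }\beta\in\mathfrak{sl}_3(\mathbb C),\ \xi,\zeta\in V.$$ Moreover, for all $\lambda,\mu\in\mathbb I$ with $\lambda\ne\mu$, $\langle V_\lambda,V_\mu\rangle=0$ and $\langle\tilde V_\lambda,\tilde V_\mu\rangle=0$.
   Context: Let $p_1,p_2,p_3,p_4\in\mathbb C$ be such that all of $p_1,\ p_2,\ p_3,\ p_4,\ p_1+p_2,\ p_1+p_3,\ p_2+p_4,\ p_3+p_4,\ p_1+p_2+p_3+p_4,\ p_1p_4-p_2p_3$ are nonzero, and let $N\ge0$ be an integer. Put $S=p_1+p_2+p_3+p_4$ and $$\mathbf t=\tfrac{(p_1+p_2)(p_1+p_3)}{p_1S},\quad \mathbf u=\tfrac{(p_1+p_3)(p_3+p_4)}{p_3S},\quad \mathbf v=\tfrac{(p_1+p_2)(p_2+p_4)}{p_2S},\quad \mathbf w=\tfrac{(p_2+p_4)(p_3+p_4)}{p_4S},$$ $\nu=\frac{(p_1+p_2)(p_1+p_3)(p_2+p_4)(p_3+p_4)}{(p_1p_4-p_2p_3)^2}$, $\tilde\eta_0=\nu^{-1}$, $\tilde\eta_1=\frac{p_1p_3S}{(p_1+p_2)(p_1+p_3)(p_3+p_4)}$, $\tilde\eta_2=\frac{p_2p_4S}{(p_1+p_2)(p_2+p_4)(p_3+p_4)}$, $\vartheta=\frac{(p_1+p_3)(p_2+p_4)}{p_2p_3-p_1p_4}$,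 $\tilde\vartheta=\frac{(p_1+p_2)(p_3+p_4)}{p_2p_3-p_1p_4}$, $\tilde W=\mathrm{diag}(\tilde\eta_0,\tilde\eta_1,\tilde\eta_2)$. For $\beta\in\mathfrak{sl}_3(\mathbb C)$ put $\beta^\dagger=\tilde W\beta^t\tilde W^{-1}$, where $\beta^t$ is the transpose. Let $x,y,z$ be commuting indeterminates, also written $x_0=x,x_1=y,x_2=z$. The Lie algebra $\mathfrak{sl}_3(\mathbb C)$ (rows and columns indexed by $0,1,2$) acts on $\mathbb C[x,y,z]$ by derivations, with $\beta.x_j=\sum_{i=0}^2\beta_{ij}x_i$. Let $V$ be the submodule of homogeneous polynomials of total degree $N$. Define $$\tilde x=\tilde\vartheta(\tilde\eta_0x+\tilde\eta_1y+\tilde\eta_2z),\quad \tilde y=\tilde\vartheta\big(\tilde\eta_0x+(1-\mathbf t)\tilde\eta_1y+(1-\mathbf v)\tilde\eta_2z\big),\quad \tilde z=\tilde\vartheta\big(\tilde\eta_0x+(1-\mathbf u)\tilde\eta_1y+(1-\mathbf w)\tilde\eta_2z\big).$$ Let $\mathbb I$ be the set of triples of nonnegative integers with sum $N$; for $\lambda=(r,s,t)\in\mathbb I$ let $V_\lambda=\mathbb C\,x^ry^sz^t$ and $\tilde V_\lambda=\mathbb C\,\tilde x^r\tilde y^s\tilde z^t$. Let $\langle\,,\,\rangle$ be the symmetric bilinear form on $V$ for which the monomials $x^ry^sz^t$ ($(r,s,t)\in\mathbb I$) are mutually orthogonal and $$\langle x^ry^sz^t,x^ry^sz^t\rangle=\frac{r!\,s!\,t!}{\tilde\eta_0^r\tilde\eta_1^s\tilde\eta_2^t}\,\vartheta^N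 .$$ *)

theory Defs
  imports "HOL-Analysis.Analysis" "HOL-Library.Poly_Mapping"
begin

text \<open>
  The index type \<open>3\<close> has exactly the elements \<open>0, 1, 2\<close>; it serves as index set both of the
  variables and of the matrices. A polynomial maps exponent vectors to coefficients, and the ring
  structure is the convolution product of \<^theory>\<open>HOL-Library.Poly_Mapping\<close>.
\<close>

type_synonym poly3 = "(3 \<Rightarrow>\<^sub>0 nat) \<Rightarrow>\<^sub>0 complex"

definition Const :: "complex \<Rightarrow> poly3" where
  "Const c = Poly_Mapping.single 0 c"

definition X :: "3 \<Rightarrow> poly3" where
  "X i = Poly_Mapping.single (Poly_Mapping.single i 1) 1"

definition monomial3 :: "poly3 \<Rightarrow> poly3 \<Rightarrow> poly3 \<Rightarrow> nat \<times> nat \<times> nat \<Rightarrow> poly3" where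
  "monomial3 a b c = (\<lambda>(r, s, t). a ^ r * b ^ s * c ^ t)"

definition homogeneous :: "nat \<Rightarrow> poly3 set" where
  "homogeneous N = {f. \<forall>m \<in> Poly_Mapping.keys f. (\<Sum>i\<in>UNIV. Poly_Mapping.lookup m i) = N}"

definition index_triples :: "nat \<Rightarrow> (nat \<times> nat \<times> nat) set" where
  "index_triples N = {(r, s, t). r + s + t = N}"

definition line :: "poly3 \<Rightarrow> poly3 set" where
  "line f = {Const c * f | c. True}"

definition sl3 :: "(complex^3^3) set" where
  "sl3 = {\<beta>. trace \<beta> = 0}"

definition is_derivation :: "(poly3 \<Rightarrow> poly3) \<Rightarrow> bool" where
  "is_derivation D \<longleftrightarrow>
     (\<forall>f g. D (f + g) = D f + D g) \<and>
     (\<forall>c f. D (Const c * f) = Const c * D f) \<and>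
     (\<forall>f g. D (f * g) = D f * g + f * D g)"

text \<open>Existence and uniqueness of this derivation is lemma \<open>act_ex1\<close> below.\<close>

definition act :: "complex^3^3 \<Rightarrow> poly3 \<Rightarrow> poly3" where
  "act \<beta> = (THE D. is_derivation D \<and> (\<forall>j. D (X j) = (\<Sum>i\<in>UNIV. Const (\<beta> $ i $ j) * X i)))"

definition diag3 :: "(3 \<Rightarrow> complex) \<Rightarrow> complex^3^3" where
  "diag3 d = (\<chi> i j. if i = j then d i else 0)"

definition S_par :: "complex \<Rightarrow> complex \<Rightarrow> complex \<Rightarrow> complex \<Rightarrow> complex" where
  "S_par p1 p2 p3 p4 = p1 + p2 + p3 + p4"

definition t_par :: "complex \<Rightarrow> complex \<Rightarrow> complex \<Rightarrow> complex \<Rightarrow> complex" where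
  "t_par p1 p2 p3 p4 = (p1 + p2) * (p1 + p3) / (p1 * S_par p1 p2 p3 p4)"

definition u_par :: "complex \<Rightarrow> complex \<Rightarrow> complex \<Rightarrow> complex \<Rightarrow> complex" where
  "u_par p1 p2 p3 p4 = (p1 + p3) * (p3 + p4) / (p3 * S_par p1 p2 p3 p4)"

definition v_par :: "complex \<Rightarrow> complex \<Rightarrow> complex \<Rightarrow> complex \<Rightarrow> complex" where
  "v_par p1 p2 p3 p4 = (p1 + p2) * (p2 + p4) / (p2 * S_par p1 p2 p3 p4)"

definition w_par :: "complex \<Rightarrow> complex \<Rightarrow> complex \<Rightarrow> complex \<Rightarrow> complex" where
  "w_par p1 p2 p3 p4 = (p2 + p4) * (p3 + p4) / (p4 * S_par p1 p2 p3 p4)"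

definition nu :: "complex \<Rightarrow> complex \<Rightarrow> complex \<Rightarrow> complex \<Rightarrow> complex" where
  "nu p1 p2 p3 p4 =
     (p1 + p2) * (p1 + p3) * (p2 + p4) * (p3 + p4) / (p1 * p4 - p2 * p3) ^ 2"

definition eta_t :: "complex \<Rightarrow> complex \<Rightarrow> complex \<Rightarrow> complex \<Rightarrow> 3 \<Rightarrow> complex" where
  "eta_t p1 p2 p3 p4 i =
     (if i = 0 then inverse (nu p1 p2 p3 p4)
      else if i = 1 then p1 * p3 * S_par p1 p2 p3 p4 / ((p1 + p2) * (p1 + p3) * (p3 + p4))
      else p2 * p4 * S_par p1 p2 p3 p4 / ((p1 + p2) * (p2 + p4) * (p3 + p4)))"

definition theta :: "complex \<Rightarrow> complex \<Rightarrow> complex \<Rightarrow> complex \<Rightarrow> complex" where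
  "theta p1 p2 p3 p4 = (p1 + p3) * (p2 + p4) / (p2 * p3 - p1 * p4)"

definition theta_t :: "complex \<Rightarrow> complex \<Rightarrow> complex \<Rightarrow> complex \<Rightarrow> complex" where
  "theta_t p1 p2 p3 p4 = (p1 + p2) * (p3 + p4) / (p2 * p3 - p1 * p4)"

definition W_t :: "complex \<Rightarrow> complex \<Rightarrow> complex \<Rightarrow> complex \<Rightarrow> complex^3^3" where
  "W_t p1 p2 p3 p4 = diag3 (eta_t p1 p2 p3 p4)"

definition dagger ::
  "complex \<Rightarrow> complex \<Rightarrow> complex \<Rightarrow> complex \<Rightarrow> complex^3^3 \<Rightarrow> complex^3^3" where
  "dagger p1 p2 p3 p4 \<beta> =
     W_t p1 p2 p3 p4 ** transpose \<beta> ** matrix_inv (W_t p1 p2 p3 p4)"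

definition x_t :: "complex \<Rightarrow> complex \<Rightarrow> complex \<Rightarrow> complex \<Rightarrow> poly3" where
  "x_t p1 p2 p3 p4 = Const (theta_t p1 p2 p3 p4) *
     (Const (eta_t p1 p2 p3 p4 0) * X 0
      + Const (eta_t p1 p2 p3 p4 1) * X 1
      + Const (eta_t p1 p2 p3 p4 2) * X 2)"

definition y_t :: "complex \<Rightarrow> complex \<Rightarrow> complex \<Rightarrow> complex \<Rightarrow> poly3" where
  "y_t p1 p2 p3 p4 = Const (theta_t p1 p2 p3 p4) *
     (Const (eta_t p1 p2 p3 p4 0) * X 0
      + Const ((1 - t_par p1 p2 p3 p4) * eta_t p1 p2 p3 p4 1) * X 1
      + Const ((1 - v_par p1 p2 p3 p4) * eta_t p1 p2 p3 p4 2) * X 2)"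

definition z_t :: "complex \<Rightarrow> complex \<Rightarrow> complex \<Rightarrow> complex \<Rightarrow> poly3" where
  "z_t p1 p2 p3 p4 = Const (theta_t p1 p2 p3 p4) *
     (Const (eta_t p1 p2 p3 p4 0) * X 0
      + Const ((1 - u_par p1 p2 p3 p4) * eta_t p1 p2 p3 p4 1) * X 1
      + Const ((1 - w_par p1 p2 p3 p4) * eta_t p1 p2 p3 p4 2) * X 2)"

definition wt_space :: "nat \<times> nat \<times> nat \<Rightarrow> poly3 set" where
  "wt_space l = line (monomial3 (X 0) (X 1) (X 2) l)"

definition wt_space_t ::
  "complex \<Rightarrow> complex \<Rightarrow> complex \<Rightarrow> complex \<Rightarrow> nat \<times> nat \<times> nat \<Rightarrow> poly3 set" where
  "wt_space_t p1 p2 p3 p4 l =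
     line (monomial3 (x_t p1 p2 p3 p4) (y_t p1 p2 p3 p4) (z_t p1 p2 p3 p4) l)"

definition monomial_norm ::
  "complex \<Rightarrow> complex \<Rightarrow> complex \<Rightarrow> complex \<Rightarrow> nat \<Rightarrow> (3 \<Rightarrow>\<^sub>0 nat) \<Rightarrow> complex" where
  "monomial_norm p1 p2 p3 p4 N m =
     (\<Prod>i\<in>UNIV. fact (Poly_Mapping.lookup m i)) /
     (\<Prod>i\<in>UNIV. eta_t p1 p2 p3 p4 i ^ Poly_Mapping.lookup m i) * theta p1 p2 p3 p4 ^ N"

text \<open>
  The bilinear extension of the prescribed values on pairs of monomials. The formula makes sense
  for all polynomials; it is only meant to be used on \<^term>\<open>homogeneous N\<close>. The lemmas
  \<open>form_*\<close> below confirm the defining properties.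
\<close>

definition form ::
  "complex \<Rightarrow> complex \<Rightarrow> complex \<Rightarrow> complex \<Rightarrow> nat \<Rightarrow> poly3 \<Rightarrow> poly3 \<Rightarrow> complex" where
  "form p1 p2 p3 p4 N f g =
     (\<Sum>m\<in>Poly_Mapping.keys f. \<Sum>n\<in>Poly_Mapping.keys g.
        Poly_Mapping.lookup f m * Poly_Mapping.lookup g n *
        (if m = n then monomial_norm p1 p2 p3 p4 N m else 0))"

definition nondegenerate_on :: "poly3 set \<Rightarrow> (poly3 \<Rightarrow> poly3 \<Rightarrow> complex) \<Rightarrow> bool" where
  "nondegenerate_on V B \<longleftrightarrow> (\<forall>\<xi>\<in>V. (\<forall>\<zeta>\<in>V. B \<xi> \<zeta> = 0) \<longrightarrow> \<xi> = 0)"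

lemma UNIV_index: "(UNIV :: 3 set) = {0, 1, 2}"
  using UNIV_3 by auto

lemma Const_mult: "Const a * Const b = Const (a * b)"
  by (simp add: Const_def mult_single)

lemma Const_1: "Const 1 = 1"
  by (simp add: Const_def)

lemma lookup_Const_mult:
  "Poly_Mapping.lookup (Const c * f) m = c * Poly_Mapping.lookup f m"
proof -
  have "Const c * f = Poly_Mapping.map ((*) c) f"
    by (simp add: Const_def mult_map_scale_conv_mult)
  then show ?thesis by (simp add: Poly_Mapping.map.rep_eq when_def)
qed

lemma pm_induct [case_names single sum]:
  fixes f :: "'a \<Rightarrow>\<^sub>0 'b::monoid_add"
  assumes single: "\<And>k v. P (Poly_Mapping.single k v)"
    and sum: "\<And>f g. P f \<Longrightarrow> P g \<Longrightarrow> P (f + g)"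
  shows "P f"
proof (induction f rule: update_induct)
  case const
  show ?case using single[of undefined 0] by simp
next
  case (update f a b)
  have "Poly_Mapping.update a b f = f + Poly_Mapping.single a b"
    by (rule poly_mapping_eqI)
      (use update(1) in \<open>auto simp: lookup_update lookup_add lookup_single when_def in_keys_iff\<close>)
  then show ?case using update sum single by simp
qed

lemma derivation_unique:
  assumes "is_derivation D" "is_derivation E" "\<And>j. D (X j) = E (X j)"
  shows "D = E"
proof -
  have add: "D (f + g) = D f + D g" "E (f + g) = E f + E g"
    and sc: "D (Const c * f) = Const c * D f" "E (Const c * f) = Const c * E f"
    and lb: "D (f * g) = D f * g + f * D g" "E (f * g) = E f * g + f * E g" for f g c
    using assms(1,2) unfolding is_derivation_def by blast+
  have one: "D 1 = 0" "E 1 = 0"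
    using lb[of 1 1] by simp_all
  have mon: "D (Poly_Mapping.single m 1) = E (Poly_Mapping.single m 1)" for m
  proof (induction m rule: pm_induct)
    case (single k v)
    show ?case
    proof (induction v)
      case 0
      then show ?case using one by simp
    next
      case (Suc v)
      have "Poly_Mapping.single (Poly_Mapping.single k (Suc v)) (1::complex)
          = X k * Poly_Mapping.single (Poly_Mapping.single k v) 1"
        by (simp add: X_def mult_single flip: single_add)
      then show ?case using Suc lb assms(3) by simp
    qed
  next
    case (sum f g)
    have "Poly_Mapping.single (f + g) (1::complex)
        = Poly_Mapping.single f 1 * Poly_Mapping.single g 1"
      by (simp add: mult_single)
    then show ?case using sum lb by simp
  qed
  have "D f = E f" for f
  proof (induction f rule: pm_induct)
    case (single k v)
    have "Poly_Mapping.single k v = Const v * Poly_Mapping.single k 1"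
      by (simp add: Const_def mult_single)
    then show ?case using sc mon by simp
  next
    case (sum f g)
    then show ?case using add by simp
  qed
  then show ?thesis by blast
qed

definition pd :: "3 \<Rightarrow> poly3 \<Rightarrow> poly3" where
  "pd j f = (\<Sum>m\<in>Poly_Mapping.keys f. Poly_Mapping.single (m - Poly_Mapping.single j 1)
     (of_nat (Poly_Mapping.lookup m j) * Poly_Mapping.lookup f m))"

lemma pd_superset:
  assumes "finite A" "Poly_Mapping.keys f \<subseteq> A"
  shows "pd j f = (\<Sum>m\<in>A. Poly_Mapping.single (m - Poly_Mapping.single j 1)
     (of_nat (Poly_Mapping.lookup m j) * Poly_Mapping.lookup f m))"
  unfolding pd_def by (rule sum.mono_neutral_left) (use assms in \<open>auto simp: in_keys_iff\<close>)

lemma pd_add: "pd j (f + g) = pd j f + pd j g"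
proof -
  let ?A = "Poly_Mapping.keys f \<union> Poly_Mapping.keys g"
  have "Poly_Mapping.keys (f + g) \<subseteq> ?A" by (rule keys_add)
  then show ?thesis
    by (simp add: pd_superset[of ?A] lookup_add distrib_left single_add sum.distrib)
qed

lemma pd_single:
  "pd j (Poly_Mapping.single m c) =
     Poly_Mapping.single (m - Poly_Mapping.single j 1) (of_nat (Poly_Mapping.lookup m j) * c)"
  by (subst pd_superset[of "{m}"]) auto

lemma shift_index:
  fixes m n :: "3 \<Rightarrow>\<^sub>0 nat"
  assumes "Poly_Mapping.lookup m j \<noteq> 0"
  shows "m + n - Poly_Mapping.single j 1 = (m - Poly_Mapping.single j 1) + n"
  by (rule poly_mapping_eqI) (use assms in \<open>auto simp: lookup_add lookup_minus lookup_single when_def\<close>)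

lemma pd_mult_single:
  "pd j (Poly_Mapping.single m a * Poly_Mapping.single n b) =
     pd j (Poly_Mapping.single m a) * Poly_Mapping.single n b
     + Poly_Mapping.single m a * pd j (Poly_Mapping.single n b)"
proof -
  have 1: "Poly_Mapping.single (m + n - Poly_Mapping.single j 1)
             (of_nat (Poly_Mapping.lookup m j) * (a * b))
      = Poly_Mapping.single (m - Poly_Mapping.single j 1 + n)
             (of_nat (Poly_Mapping.lookup m j) * a * b)"
    using shift_index[of m j n] by (cases "Poly_Mapping.lookup m j = 0") (auto simp: mult.assoc)
  have 2: "Poly_Mapping.single (m + n - Poly_Mapping.single j 1)
             (of_nat (Poly_Mapping.lookup n j) * (a * b))
      = Poly_Mapping.single (m + (n - Poly_Mapping.single j 1))
             (a * (of_nat (Poly_Mapping.lookup n j) * b))"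
    using shift_index[of n j m]
    by (cases "Poly_Mapping.lookup n j = 0") (auto simp: ac_simps)
  show ?thesis
    unfolding mult_single pd_single lookup_add of_nat_add distrib_right single_add
    using 1 2 by simp
qed

lemma pd_mult: "pd j (f * g) = pd j f * g + f * pd j g"
proof (induction f rule: pm_induct)
  case (single m a)
  show ?case
  proof (induction g rule: pm_induct)
    case (single n b)
    show ?case by (rule pd_mult_single)
  next
    case (sum g h)
    then show ?case by (simp add: distrib_left pd_add)
  qed
next
  case (sum f h)
  then show ?case by (simp add: distrib_right pd_add)
qed

lemma pd_Const: "pd j (Const c) = 0"
  by (simp add: Const_def pd_single)

lemma pd_X: "pd j (X i) = (if i = j then 1 else 0)"
  by (simp add: X_def pd_single lookup_single when_def)

lemma act_ex1:
  "\<exists>!D. is_derivation D \<and> (\<forall>j. D (X j) = (\<Sum>i\<in>UNIV. Const (\<beta> $ i $ j) * X i))"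
proof -
  define L where "L j = (\<Sum>i\<in>UNIV. Const (\<beta> $ i $ j) * X i)" for j
  define D where "D f = (\<Sum>j\<in>UNIV. pd j f * L j)" for f
  have "is_derivation D"
    unfolding is_derivation_def D_def
    by (auto simp: pd_add pd_mult pd_Const sum.distrib sum_distrib_left sum_distrib_right
        algebra_simps)
  moreover have "D (X j) = L j" for j
  proof -
    have "D (X j) = (\<Sum>i\<in>UNIV. if j = i then L i else 0)"
      unfolding D_def by (intro sum.cong) (auto simp: pd_X)
    then show ?thesis by simp
  qed
  ultimately show ?thesis
    using derivation_unique unfolding L_def by (intro ex1I[of _ D]) metis+
qed

lemma act_derivation: "is_derivation (act \<beta>)"
  and act_X: "act \<beta> (X j) = (\<Sum>i\<in>UNIV. Const (\<beta> $ i $ j) * X i)"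
  using theI'[OF act_ex1[of \<beta>]] unfolding act_def by blast+

lemma form_superset:
  assumes "finite A" "Poly_Mapping.keys f \<subseteq> A" "finite B" "Poly_Mapping.keys g \<subseteq> B"
  shows "form p1 p2 p3 p4 N f g =
     (\<Sum>m\<in>A. \<Sum>n\<in>B. Poly_Mapping.lookup f m * Poly_Mapping.lookup g n *
        (if m = n then monomial_norm p1 p2 p3 p4 N m else 0))"
proof -
  have "form p1 p2 p3 p4 N f g =
     (\<Sum>m\<in>Poly_Mapping.keys f. \<Sum>n\<in>B. Poly_Mapping.lookup f m * Poly_Mapping.lookup g n *
        (if m = n then monomial_norm p1 p2 p3 p4 N m else 0))"
    unfolding form_def
    by (intro sum.cong refl sum.mono_neutral_left) (use assms in \<open>auto simp: in_keys_iff\<close>)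
  also have "\<dots> = (\<Sum>m\<in>A. \<Sum>n\<in>B. Poly_Mapping.lookup f m * Poly_Mapping.lookup g n *
        (if m = n then monomial_norm p1 p2 p3 p4 N m else 0))"
    by (intro sum.mono_neutral_left) (use assms in \<open>auto simp: in_keys_iff\<close>)
  finally show ?thesis .
qed

lemma form_sym: "form p1 p2 p3 p4 N f g = form p1 p2 p3 p4 N g f"
  unfolding form_def
  by (subst sum.swap) (intro sum.cong refl, auto)

lemma form_add_left: "form p1 p2 p3 p4 N (f + g) h = form p1 p2 p3 p4 N f h + form p1 p2 p3 p4 N g h"
proof -
  let ?A = "Poly_Mapping.keys f \<union> Poly_Mapping.keys g" and ?B = "Poly_Mapping.keys h"
  have "Poly_Mapping.keys (f + g) \<subseteq> ?A" by (rule keys_add)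
  then show ?thesis
    by (simp add: form_superset[of ?A _ ?B] lookup_add distrib_right sum.distrib)
qed

lemma form_scale_left: "form p1 p2 p3 p4 N (Const c * f) g = c * form p1 p2 p3 p4 N f g"
proof -
  have "Poly_Mapping.keys (Const c * f) \<subseteq> Poly_Mapping.keys f"
    by (auto simp: in_keys_iff lookup_Const_mult)
  then show ?thesis
    by (simp add: form_superset[of "Poly_Mapping.keys f" _ "Poly_Mapping.keys g"]
        lookup_Const_mult sum_distrib_left mult.assoc)
qed

definition expo :: "nat \<times> nat \<times> nat \<Rightarrow> (3 \<Rightarrow>\<^sub>0 nat)" where
  "expo = (\<lambda>(r, s, t). Poly_Mapping.single 0 r + Poly_Mapping.single 1 s + Poly_Mapping.single 2 t)"

lemma X_power: "X i ^ n = Poly_Mapping.single (Poly_Mapping.single i n) 1"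
  by (induction n) (simp_all add: X_def mult_single flip: single_add)

lemma monomial3_X: "monomial3 (X 0) (X 1) (X 2) l = Poly_Mapping.single (expo l) 1"
  by (cases l) (simp add: monomial3_def expo_def X_power mult_single)

lemma lookup_expo:
  "Poly_Mapping.lookup (expo (r, s, t)) 0 = r"
  "Poly_Mapping.lookup (expo (r, s, t)) 1 = s"
  "Poly_Mapping.lookup (expo (r, s, t)) 2 = t"
  by (simp_all add: expo_def lookup_add lookup_single when_def)

lemma form_monomial_orthogonal:
  assumes "l \<noteq> l'"
  shows "form p1 p2 p3 p4 N (monomial3 (X 0) (X 1) (X 2) l) (monomial3 (X 0) (X 1) (X 2) l') = 0"
proof -
  have "expo l \<noteq> expo l'"
    using assms lookup_expo by (cases l; cases l') metis
  then show ?thesis by (simp add: form_def monomial3_X)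
qed

lemma form_monomial_self:
  "form p1 p2 p3 p4 N (monomial3 (X 0) (X 1) (X 2) (r, s, t))
      (monomial3 (X 0) (X 1) (X 2) (r, s, t)) =
   fact r * fact s * fact t /
   (eta_t p1 p2 p3 p4 0 ^ r * eta_t p1 p2 p3 p4 1 ^ s * eta_t p1 p2 p3 p4 2 ^ t)
   * theta p1 p2 p3 p4 ^ N"
proof -
  have prod3: "prod h (UNIV :: 3 set) = h 0 * h 1 * h 2" for h :: "3 \<Rightarrow> complex"
    unfolding UNIV_index by (simp add: mult.assoc)
  show ?thesis
    by (simp add: form_def monomial3_X monomial_norm_def prod3 lookup_expo)
qed

end

(*
  Under the form, multiplication by the variable x_i is adjoint, up to the factor 1 / eta_i, to the
  partial derivative in x_i. Invariance under sl_3 follows because beta acts as the sum of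
  beta_ij x_i d/dx_j. Multiplication by a linear form L is adjoint to a constant-coefficient
  derivation which annihilates every linear form orthogonal to L. Since x~, y~, z~ are mutually
  orthogonal for N = 1, moving the factors of a monomial in x~, y~, z~ one by one across the form
  exhibits orthogonality for every N.
*)
theory Submission
  imports Defs
begin

section \<open>Constants, sums over the three indices, scalars under partial derivatives\<close>

lemma Const_add: "Const (a + b) = Const a + Const b"
  by (simp add: Const_def single_add)

lemma Const_0 [simp]: "Const 0 = 0"
  by (simp add: Const_def)

lemma Const_sum: "Const (sum h A) = (\<Sum>a\<in>A. Const (h a))"
  by (induction A rule: infinite_finite_induct) (simp_all add: Const_add)

lemma sum_UNIV_3:
  fixes h :: "3 \<Rightarrow> 'a::comm_monoid_add"
  shows "sum h UNIV = h 0 + h 1 + h 2"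
  unfolding UNIV_index by (simp add: add.assoc)

lemma pd_scale: "pd j (Const c * f) = Const c * pd j f"
  by (simp add: pd_mult pd_Const)

section \<open>Bilinearity and nondegeneracy of the form\<close>

lemma form_add_right:
  "form p1 p2 p3 p4 N f (g + h) = form p1 p2 p3 p4 N f g + form p1 p2 p3 p4 N f h"
  by (metis form_add_left form_sym)

lemma form_scale_right: "form p1 p2 p3 p4 N f (Const c * g) = c * form p1 p2 p3 p4 N f g"
  by (metis form_scale_left form_sym)

lemma form_zero_left [simp]: "form p1 p2 p3 p4 N 0 g = 0"
  and form_zero_right [simp]: "form p1 p2 p3 p4 N f 0 = 0"
  by (simp_all add: form_def)

lemma form_sum_left: "form p1 p2 p3 p4 N (sum h A) g = (\<Sum>a\<in>A. form p1 p2 p3 p4 N (h a) g)"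
  by (induction A rule: infinite_finite_induct) (simp_all add: form_add_left)

lemma form_sum_right: "form p1 p2 p3 p4 N f (sum h A) = (\<Sum>a\<in>A. form p1 p2 p3 p4 N f (h a))"
  by (induction A rule: infinite_finite_induct) (simp_all add: form_add_right)

lemma form_single_right:
  "form p1 p2 p3 p4 N f (Poly_Mapping.single m 1) =
     Poly_Mapping.lookup f m * monomial_norm p1 p2 p3 p4 N m"
proof -
  \<comment> \<open>Inserting \<open>m\<close> lets the sum collapse at \<open>m\<close> even when
    its coefficient in \<open>f\<close> is zero.\<close>
  let ?A = "insert m (Poly_Mapping.keys f)"
  have "form p1 p2 p3 p4 N f (Poly_Mapping.single m 1) =
      (\<Sum>k\<in>?A. Poly_Mapping.lookup f k * (if k = m then monomial_norm p1 p2 p3 p4 N k else 0))"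
    by (subst form_superset[of ?A _ "{m}"]) auto
  also have "\<dots> =
      (\<Sum>k\<in>?A. if k = m then Poly_Mapping.lookup f k * monomial_norm p1 p2 p3 p4 N k else 0)"
    by (intro sum.cong) auto
  also have "\<dots> = Poly_Mapping.lookup f m * monomial_norm p1 p2 p3 p4 N m"
    by (subst sum.delta) auto
  finally show ?thesis .
qed

lemma eta_t_nonzero:
  assumes "p1 \<noteq> 0" "p2 \<noteq> 0" "p3 \<noteq> 0" "p4 \<noteq> 0"
    and "p1 + p2 \<noteq> 0" "p1 + p3 \<noteq> 0" "p2 + p4 \<noteq> 0" "p3 + p4 \<noteq> 0"
    and "p1 + p2 + p3 + p4 \<noteq> 0" "p1 * p4 - p2 * p3 \<noteq> 0"
  shows "eta_t p1 p2 p3 p4 i \<noteq> 0"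
  using assms by (simp add: eta_t_def nu_def S_par_def)

text \<open>Pairing with a monomial reads off one coefficient times a nonzero norm. A monomial
  occurring in a homogeneous \<open>f\<close> has degree \<open>N\<close> itself, hence is an
  admissible test vector.\<close>

lemma nondegenerate_form:
  assumes "\<And>i. eta_t p1 p2 p3 p4 i \<noteq> 0" "theta p1 p2 p3 p4 \<noteq> 0"
  shows "nondegenerate_on (homogeneous N) (form p1 p2 p3 p4 N)"
  unfolding nondegenerate_on_def
proof (intro ballI impI)
  fix f assume f: "f \<in> homogeneous N" and orth: "\<forall>g\<in>homogeneous N. form p1 p2 p3 p4 N f g = 0"
  have "Poly_Mapping.lookup f m = 0" for m
  proof (rule ccontr)
    assume nz: "Poly_Mapping.lookup f m \<noteq> 0"
    then have "Poly_Mapping.single m 1 \<in> homogeneous N"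
      using f by (simp add: homogeneous_def in_keys_iff)
    then have "Poly_Mapping.lookup f m * monomial_norm p1 p2 p3 p4 N m = 0"
      using orth form_single_right by metis
    moreover have "monomial_norm p1 p2 p3 p4 N m \<noteq> 0"
      using assms by (simp add: monomial_norm_def)
    ultimately show False using nz by simp
  qed
  then show "f = 0" by (intro poly_mapping_eqI) simp
qed

section \<open>Adjointness of multiplication and differentiation\<close>

text \<open>Adjointness on the level of norms: raising the exponent of \<open>X i\<close> by one
  multiplies the factorials by the new exponent and the denominator by the weight at
  \<open>i\<close>. The power of \<open>theta\<close> stays \<open>N\<close> whatever the degree of
  \<open>m\<close>.\<close>

lemma monomial_norm_shift:
  assumes "eta_t p1 p2 p3 p4 i \<noteq> 0"
  shows "eta_t p1 p2 p3 p4 i * monomial_norm p1 p2 p3 p4 N (m + Poly_Mapping.single i 1) =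
    of_nat (Suc (Poly_Mapping.lookup m i)) * monomial_norm p1 p2 p3 p4 N m"
proof -
  have fac: "(\<Prod>k\<in>UNIV. fact (Poly_Mapping.lookup (m + Poly_Mapping.single i 1) k)) =
      of_nat (Suc (Poly_Mapping.lookup m i)) *
      (\<Prod>k\<in>UNIV. fact (Poly_Mapping.lookup m k) :: complex)"
  proof -
    have "(\<Prod>k\<in>UNIV. fact (Poly_Mapping.lookup (m + Poly_Mapping.single i 1) k)) =
      (\<Prod>k\<in>UNIV. (if k = i then of_nat (Suc (Poly_Mapping.lookup m i)) else 1) *
         (fact (Poly_Mapping.lookup m k) :: complex))"
      by (intro prod.cong) (auto simp: lookup_add lookup_single when_def)
    then show ?thesis by (simp add: prod.distrib)
  qed
  have pow: "(\<Prod>k\<in>UNIV. eta_t p1 p2 p3 p4 k ^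
        Poly_Mapping.lookup (m + Poly_Mapping.single i 1) k) =
      eta_t p1 p2 p3 p4 i * (\<Prod>k\<in>UNIV. eta_t p1 p2 p3 p4 k ^ Poly_Mapping.lookup m k)"
  proof -
    have "(\<Prod>k\<in>UNIV. eta_t p1 p2 p3 p4 k ^
        Poly_Mapping.lookup (m + Poly_Mapping.single i 1) k) =
      (\<Prod>k\<in>UNIV. (if k = i then eta_t p1 p2 p3 p4 i else 1) *
        eta_t p1 p2 p3 p4 k ^ Poly_Mapping.lookup m k)"
      by (intro prod.cong) (auto simp: lookup_add lookup_single when_def)
    then show ?thesis by (simp add: prod.distrib)
  qed
  show ?thesis
    unfolding monomial_norm_def fac pow using assms by simp
qed

text \<open>Bilinearity reduces the claim to single terms. The two sides pair polynomials of
  different degrees, but \<open>form\<close> is defined on all polynomials and \<open>N\<close>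
  enters only through the power of \<open>theta\<close>, so the same \<open>N\<close> serves
  both.\<close>

lemma form_X_mult:
  assumes "eta_t p1 p2 p3 p4 i \<noteq> 0"
  shows "eta_t p1 p2 p3 p4 i * form p1 p2 p3 p4 N (X i * f) g = form p1 p2 p3 p4 N f (pd i g)"
proof (induction f rule: pm_induct)
  case (single m a)
  show ?case
  proof (induction g rule: pm_induct)
    case (single n b)
    let ?e = "Poly_Mapping.single i (1::nat)"
    have lhs: "form p1 p2 p3 p4 N (X i * Poly_Mapping.single m a) (Poly_Mapping.single n b) =
        a * b * (if m + ?e = n then monomial_norm p1 p2 p3 p4 N n else 0)"
      by (simp add: X_def mult_single add.commute form_superset[of "{m + ?e}" _ "{n}"])
    have rhs: "form p1 p2 p3 p4 N (Poly_Mapping.single m a) (pd i (Poly_Mapping.single n b)) =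
        a * (of_nat (Poly_Mapping.lookup n i) * b) *
        (if m = n - ?e then monomial_norm p1 p2 p3 p4 N m else 0)"
      by (simp add: pd_single form_superset[of "{m}" _ "{n - ?e}"])
    show ?case
    proof (cases "m + ?e = n")
      case True
      then have "m = n - ?e" and "Poly_Mapping.lookup n i = Suc (Poly_Mapping.lookup m i)"
        by (auto simp: lookup_add)
      then show ?thesis
        unfolding lhs rhs using True monomial_norm_shift[OF assms, of N m]
        by (simp add: algebra_simps)
    next
      case False
      \<comment> \<open>Subtraction of exponents truncates, so \<open>m = n - ?e\<close> can hold
        without \<open>m + ?e = n\<close>. This happens only if \<open>n\<close> has exponent 0 at
        \<open>i\<close>, and then the factor produced by \<open>pd i\<close> vanishes.\<close>
      have "n = (n - ?e) + ?e" if "Poly_Mapping.lookup n i \<noteq> 0"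
        by (rule poly_mapping_eqI)
          (use that in \<open>auto simp: lookup_add lookup_minus lookup_single when_def\<close>)
      then have "Poly_Mapping.lookup n i = 0 \<or> m \<noteq> n - ?e"
        using False by auto
      then show ?thesis unfolding lhs rhs using False by auto
    qed
  next
    case (sum g h)
    then show ?case by (simp add: form_add_right pd_add distrib_left)
  qed
next
  case (sum f h)
  then show ?case by (simp add: form_add_left distrib_left)
qed

section \<open>The action of \<open>sl\<^sub>3\<close>\<close>

text \<open>A derivation is determined by its values on the variables, and the sum on the right is a
  derivation with the values prescribed for \<open>act\<close>.\<close>

lemma act_eq: "act \<beta> f = (\<Sum>j\<in>UNIV. \<Sum>i\<in>UNIV. Const (\<beta> $ i $ j) * (X i * pd j f))"
proof -
  define D where "D f = (\<Sum>j\<in>UNIV. \<Sum>i\<in>UNIV. Const (\<beta> $ i $ j) * (X i * pd j f))" for f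
  have "is_derivation D"
    unfolding is_derivation_def D_def
    by (auto simp: pd_add pd_mult pd_Const sum.distrib sum_distrib_left sum_distrib_right
        algebra_simps)
  moreover have "D (X j) = (\<Sum>i\<in>UNIV. Const (\<beta> $ i $ j) * X i)" for j
  proof -
    have "D (X j) = (\<Sum>k\<in>UNIV. if j = k then \<Sum>i\<in>UNIV. Const (\<beta> $ i $ k) * X i else 0)"
      unfolding D_def by (intro sum.cong) (auto simp: pd_X)
    then show ?thesis by simp
  qed
  ultimately have "act \<beta> = D"
    by (intro derivation_unique act_derivation) (simp_all add: act_X)
  then show ?thesis by (simp add: D_def)
qed

lemma diag3_mult_nth:
  shows diag3_mult_left_nth: "(diag3 d ** A) $ i $ j = d i * A $ i $ j"
    and diag3_mult_right_nth: "(A ** diag3 d) $ i $ j = A $ i $ j * d j"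
proof -
  have "(diag3 d ** A) $ i $ j = (\<Sum>k\<in>UNIV. if k = i then d k * A $ k $ j else 0)"
    unfolding matrix_matrix_mult_def diag3_def vec_lambda_beta by (intro sum.cong) auto
  then show "(diag3 d ** A) $ i $ j = d i * A $ i $ j" by simp
  have "(A ** diag3 d) $ i $ j = (\<Sum>k\<in>UNIV. if k = j then A $ i $ k * d k else 0)"
    unfolding matrix_matrix_mult_def diag3_def vec_lambda_beta by (intro sum.cong) auto
  then show "(A ** diag3 d) $ i $ j = A $ i $ j * d j" by simp
qed

text \<open>\<open>matrix_inv\<close> is given by choice; exhibiting one two-sided inverse shows
  that the chosen matrix is an inverse, and associativity identifies the two.\<close>

lemma matrix_inv_unique:
  fixes A B :: "'a::semiring_1^'n^'n"
  assumes "A ** B = mat 1" "B ** A = mat 1"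
  shows "matrix_inv A = B"
proof -
  have "A ** matrix_inv A = mat 1"
    unfolding matrix_inv_def using assms by (rule someI2[of _ B, OF conjI]) simp
  then have "B ** (A ** matrix_inv A) = B" by simp
  then show ?thesis unfolding matrix_mul_assoc using assms by simp
qed

lemma matrix_inv_diag3:
  assumes "\<And>i. d i \<noteq> 0"
  shows "matrix_inv (diag3 d) = diag3 (\<lambda>i. inverse (d i))"
proof -
  have "diag3 d ** diag3 (\<lambda>i. inverse (d i)) = mat 1"
    "diag3 (\<lambda>i. inverse (d i)) ** diag3 d = mat 1"
    unfolding vec_eq_iff diag3_mult_left_nth using assms by (auto simp: diag3_def mat_def)
  then show ?thesis by (rule matrix_inv_unique)
qed

lemma dagger_nth:
  assumes "\<And>i. eta_t p1 p2 p3 p4 i \<noteq> 0"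
  shows "dagger p1 p2 p3 p4 \<beta> $ i $ j =
    eta_t p1 p2 p3 p4 i * \<beta> $ j $ i / eta_t p1 p2 p3 p4 j"
  unfolding dagger_def W_t_def matrix_inv_diag3[OF assms] diag3_mult_right_nth
    diag3_mult_left_nth
  by (simp add: transpose_def divide_inverse)

text \<open>The adjoint of \<open>X i * pd j\<close> is \<open>X j * pd i\<close> times the quotient
  of the weights at \<open>j\<close> and \<open>i\<close>. This quotient is exactly what conjugation
  by \<open>W_t\<close> contributes to the transposed entry.\<close>

lemma form_act:
  assumes nz: "\<And>i. eta_t p1 p2 p3 p4 i \<noteq> 0"
  shows "form p1 p2 p3 p4 N (act \<beta> f) g = form p1 p2 p3 p4 N f (act (dagger p1 p2 p3 p4 \<beta>) g)"
proof -
  let ?B = "form p1 p2 p3 p4 N" and ?e = "eta_t p1 p2 p3 p4"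
  have *: "\<beta> $ i $ j * ?B (X i * pd j f) g =
      ?e j * \<beta> $ i $ j / ?e i * ?B f (X j * pd i g)" for i j
  proof -
    \<comment> \<open>Both expressions equal the pairing of \<open>pd j f\<close> with
      \<open>pd i g\<close>, so symmetry of the form connects them.\<close>
    have "?e i * ?B (X i * pd j f) g = ?B (pd i g) (pd j f)"
      by (metis form_X_mult[OF nz] form_sym)
    also have "\<dots> = ?e j * ?B f (X j * pd i g)"
      by (metis form_X_mult[OF nz] form_sym)
    finally show ?thesis using nz[of i] by (simp add: field_simps)
  qed
  have "?B (act \<beta> f) g = (\<Sum>j\<in>UNIV. \<Sum>i\<in>UNIV. \<beta> $ i $ j * ?B (X i * pd j f) g)"
    by (simp add: act_eq form_sum_left form_scale_left)
  also have "\<dots> = (\<Sum>i\<in>UNIV. \<Sum>j\<in>UNIV. ?e j * \<beta> $ i $ j / ?e i * ?B f (X j * pd i g))"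
    unfolding * by (rule sum.swap)
  also have "\<dots> = ?B f (act (dagger p1 p2 p3 p4 \<beta>) g)"
    by (simp add: act_eq form_sum_right form_scale_right dagger_nth[OF nz])
  finally show ?thesis .
qed

section \<open>Orthogonality of monomials in orthogonal linear forms\<close>

definition lin :: "(3 \<Rightarrow> complex) \<Rightarrow> poly3" where
  "lin c = (\<Sum>i\<in>UNIV. Const (c i) * X i)"

definition dir_deriv :: "(3 \<Rightarrow> complex) \<Rightarrow> poly3 \<Rightarrow> poly3" where
  "dir_deriv a f = (\<Sum>i\<in>UNIV. Const (a i) * pd i f)"

lemma dir_deriv_mult: "dir_deriv a (f * g) = dir_deriv a f * g + f * dir_deriv a g"
  unfolding dir_deriv_def
  by (simp add: pd_mult sum.distrib sum_distrib_left sum_distrib_right algebra_simps)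

lemma dir_deriv_1: "dir_deriv a 1 = 0"
  using dir_deriv_mult[of a 1 1] by simp

lemma dir_deriv_power: "dir_deriv a (f ^ Suc n) = of_nat (Suc n) * f ^ n * dir_deriv a f"
  by (induction n) (simp_all add: dir_deriv_mult algebra_simps)

lemma dir_deriv_power_eq_0: "dir_deriv a f = 0 \<Longrightarrow> dir_deriv a (f ^ n) = 0"
  by (cases n) (simp_all add: dir_deriv_1 dir_deriv_power del: power_Suc)

text \<open>For \<open>c i\<close> equal to the weight at \<open>i\<close> times \<open>b i\<close>,
  this constant is the weighted pairing of \<open>a\<close> and \<open>b\<close>, which is the form
  on linear polynomials for N = 1 up to the factor \<open>theta\<close>.\<close>

lemma dir_deriv_lin: "dir_deriv a (lin c) = Const (\<Sum>i\<in>UNIV. a i * c i)"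
proof -
  have "pd i (lin c) = Const (c i)" for i
  proof -
    have "pd i (lin c) = (\<Sum>j\<in>UNIV. if j = i then Const (c j) else 0)"
      unfolding lin_def sum_UNIV_3 by (simp add: pd_add pd_scale pd_X)
    then show ?thesis by simp
  qed
  then show ?thesis by (simp add: dir_deriv_def Const_sum Const_mult)
qed

text \<open>Writing the coefficients as weight times \<open>a i\<close> cancels the inverse weights
  in the adjoint of \<open>X i\<close>, leaving the plain derivation along \<open>a\<close>.\<close>

lemma form_lin_mult:
  assumes nz: "\<And>i. eta_t p1 p2 p3 p4 i \<noteq> 0"
  shows "form p1 p2 p3 p4 N (lin (\<lambda>i. eta_t p1 p2 p3 p4 i * a i) * f) g =
    form p1 p2 p3 p4 N f (dir_deriv a g)"
proof -
  have "form p1 p2 p3 p4 N (lin (\<lambda>i. eta_t p1 p2 p3 p4 i * a i) * f) g =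
      (\<Sum>i\<in>UNIV. a i * (eta_t p1 p2 p3 p4 i * form p1 p2 p3 p4 N (X i * f) g))"
    by (simp add: lin_def sum_distrib_right form_sum_left form_scale_left mult.assoc)
      (simp add: mult.left_commute)
  then show ?thesis
    by (simp add: form_X_mult[OF nz] dir_deriv_def form_sum_right form_scale_right)
qed

text \<open>Each factor \<open>l\<close> moved to the right lowers the power of \<open>l\<close>
  there by one, up to a scalar, because the derivation kills \<open>g\<close>. After
  \<open>s\<close> moves a further factor remains on the left, and moving it differentiates
  \<open>g\<close> to zero.\<close>

lemma form_lin_power_less:
  assumes nz: "\<And>i. eta_t p1 p2 p3 p4 i \<noteq> 0"
    and g: "dir_deriv a g = 0"
    and "s < r"
  defines "l \<equiv> lin (\<lambda>i. eta_t p1 p2 p3 p4 i * a i)"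
  shows "form p1 p2 p3 p4 N (l ^ r * f) (l ^ s * g) = 0"
  using \<open>s < r\<close>
proof (induction s arbitrary: r)
  case 0
  then obtain r' where r: "r = Suc r'" by (cases r) auto
  show ?case
    using form_lin_mult[OF nz, of N a "l ^ r' * f" g] g unfolding r l_def
    by (simp add: mult.assoc)
next
  case (Suc s)
  then obtain r' where r: "r = Suc r'" "s < r'" by (cases r) auto
  obtain c where c: "dir_deriv a l = Const c" unfolding l_def dir_deriv_lin by blast
  \<comment> \<open>The integer factor from the power rule is a polynomial; as a
    \<open>Const\<close> it can be pulled out of the form.\<close>
  have "of_nat n = Const (of_nat n)" for n
    by (induction n) (simp_all add: Const_add Const_1)
  then have "dir_deriv a (l ^ Suc s * g) = Const (of_nat (Suc s) * c) * (l ^ s * g)"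
    unfolding dir_deriv_mult dir_deriv_power c g by (simp add: ac_simps flip: Const_mult)
  then have "form p1 p2 p3 p4 N (l ^ r * f) (l ^ Suc s * g) =
      of_nat (Suc s) * c * form p1 p2 p3 p4 N (l ^ r' * f) (l ^ s * g)"
    using form_lin_mult[OF nz, of N a "l ^ r' * f" "l ^ Suc s * g"]
    unfolding r l_def[symmetric] by (simp add: form_scale_right mult.assoc)
  then show ?case using Suc.IH[OF r(2)] by simp
qed

lemma form_lin_power_neq:
  assumes "\<And>i. eta_t p1 p2 p3 p4 i \<noteq> 0"
    and "dir_deriv a f = 0" "dir_deriv a g = 0"
    and "r \<noteq> s"
  defines "l \<equiv> lin (\<lambda>i. eta_t p1 p2 p3 p4 i * a i)"
  shows "form p1 p2 p3 p4 N (l ^ r * f) (l ^ s * g) = 0"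
proof (cases "s < r")
  case True
  then show ?thesis unfolding l_def using form_lin_power_less[OF assms(1,3)] by blast
next
  case False
  then have "r < s" using assms by simp
  then show ?thesis
    unfolding l_def using form_lin_power_less[OF assms(1,2)] by (subst form_sym) blast
qed

text \<open>Some exponent differs. The corresponding linear form is put in front, and its derivation
  kills the other two forms, hence all products of their powers.\<close>

lemma form_monomial3_lin:
  fixes p1 p2 p3 p4 :: complex
  defines "L \<equiv> \<lambda>a. lin (\<lambda>i. eta_t p1 p2 p3 p4 i * a i)"
  assumes nz: "\<And>i. eta_t p1 p2 p3 p4 i \<noteq> 0"
    and ab: "(\<Sum>i\<in>UNIV. eta_t p1 p2 p3 p4 i * a i * b i) = 0"
    and ac: "(\<Sum>i\<in>UNIV. eta_t p1 p2 p3 p4 i * a i * c i) = 0"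
    and bc: "(\<Sum>i\<in>UNIV. eta_t p1 p2 p3 p4 i * b i * c i) = 0"
    and "k \<noteq> m"
  shows "form p1 p2 p3 p4 N (monomial3 (L a) (L b) (L c) k) (monomial3 (L a) (L b) (L c) m) = 0"
proof -
  have L: "dir_deriv d (L d') = 0" "dir_deriv d' (L d) = 0"
    if "(\<Sum>i\<in>UNIV. eta_t p1 p2 p3 p4 i * d i * d' i) = 0" for d d'
    unfolding L_def dir_deriv_lin using that by (simp_all add: ac_simps)
  note orth = L[OF ab] L[OF ac] L[OF bc]
  have prod0: "dir_deriv d (f ^ i * g ^ j) = 0" if "dir_deriv d f = 0" "dir_deriv d g = 0"
    for d f g i j
    using that by (simp add: dir_deriv_mult dir_deriv_power_eq_0)
  have neq: "form p1 p2 p3 p4 N (L d ^ r * f) (L d ^ s * g) = 0"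
    if "dir_deriv d f = 0" "dir_deriv d g = 0" "r \<noteq> s" for d f g r s
    unfolding L_def using form_lin_power_neq[OF nz that] .
  obtain r s t where k: "k = (r, s, t)" by (cases k)
  obtain r' s' t' where m: "m = (r', s', t')" by (cases m)
  consider "r \<noteq> r'" | "s \<noteq> s'" | "t \<noteq> t'" using \<open>k \<noteq> m\<close> k m by auto
  then show ?thesis
  proof cases
    case 1
    have "form p1 p2 p3 p4 N (L a ^ r * (L b ^ s * L c ^ t)) (L a ^ r' * (L b ^ s' * L c ^ t')) = 0"
      by (intro neq prod0 orth 1)
    then show ?thesis by (simp add: k m monomial3_def ac_simps)
  next
    case 2
    have "form p1 p2 p3 p4 N (L b ^ s * (L a ^ r * L c ^ t)) (L b ^ s' * (L a ^ r' * L c ^ t')) = 0"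
      by (intro neq prod0 orth 2)
    then show ?thesis by (simp add: k m monomial3_def ac_simps)
  next
    case 3
    have "form p1 p2 p3 p4 N (L c ^ t * (L a ^ r * L b ^ s)) (L c ^ t' * (L a ^ r' * L b ^ s')) = 0"
      by (intro neq prod0 orth 3)
    then show ?thesis by (simp add: k m monomial3_def ac_simps)
  qed
qed

section \<open>Weight lines and the explicit tilde variables\<close>

lemma form_line_zero:
  assumes "form p1 p2 p3 p4 N f g = 0" "\<xi> \<in> line f" "\<zeta> \<in> line g"
  shows "form p1 p2 p3 p4 N \<xi> \<zeta> = 0"
  using assms by (auto simp: line_def form_scale_left form_scale_right)

text \<open>All four differences share the numerator \<open>p1 * p4 - p2 * p3\<close> up to sign;
  for the first, \<open>p1 * S - (p1 + p2) * (p1 + p3)\<close> expands to it.\<close>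

lemma one_minus_pars:
  assumes "p1 \<noteq> 0" "p2 \<noteq> 0" "p3 \<noteq> 0" "p4 \<noteq> 0" "S_par p1 p2 p3 p4 \<noteq> 0"
  shows "1 - t_par p1 p2 p3 p4 = (p1 * p4 - p2 * p3) / (p1 * S_par p1 p2 p3 p4)"
    and "1 - u_par p1 p2 p3 p4 = - (p1 * p4 - p2 * p3) / (p3 * S_par p1 p2 p3 p4)"
    and "1 - v_par p1 p2 p3 p4 = - (p1 * p4 - p2 * p3) / (p2 * S_par p1 p2 p3 p4)"
    and "1 - w_par p1 p2 p3 p4 = (p1 * p4 - p2 * p3) / (p4 * S_par p1 p2 p3 p4)"
  using assms unfolding t_par_def u_par_def v_par_def w_par_def
  by (simp_all add: field_simps) (simp_all add: S_par_def algebra_simps)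

text \<open>The vectors (1, 1, 1), (1, 1-t, 1-v) and (1, 1-u, 1-w) are mutually orthogonal for the
  weights \<open>e\<close>.\<close>

lemma tilde_orthogonality:
  fixes p1 p2 p3 p4 :: complex
  assumes "p1 \<noteq> 0" "p2 \<noteq> 0" "p3 \<noteq> 0" "p4 \<noteq> 0"
    and "p1 + p2 \<noteq> 0" "p1 + p3 \<noteq> 0" "p2 + p4 \<noteq> 0" "p3 + p4 \<noteq> 0"
    and "p1 + p2 + p3 + p4 \<noteq> 0" "p1 * p4 - p2 * p3 \<noteq> 0"
  defines "e \<equiv> eta_t p1 p2 p3 p4"
    and "t \<equiv> t_par p1 p2 p3 p4" and "u \<equiv> u_par p1 p2 p3 p4"
    and "v \<equiv> v_par p1 p2 p3 p4" and "w \<equiv> w_par p1 p2 p3 p4"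
  shows "e 0 + e 1 * (1 - t) + e 2 * (1 - v) = 0"
    and "e 0 + e 1 * (1 - u) + e 2 * (1 - w) = 0"
    and "e 0 + e 1 * (1 - t) * (1 - u) + e 2 * (1 - v) * (1 - w) = 0"
proof -
  define d where "d = p1 * p4 - p2 * p3"
  define S where "S = S_par p1 p2 p3 p4"
  \<comment> \<open>Keeping the pair sums opaque lets the denominators clear without expansion. Each
    sum then factors, and the remaining factor vanishes once the abbreviations it contains are
    unfolded.\<close>
  define A B C D where "A = p1 + p2" and "B = p1 + p3" and "C = p2 + p4" and "D = p3 + p4"
  have nz: "d \<noteq> 0" "S \<noteq> 0" "A \<noteq> 0" "B \<noteq> 0" "C \<noteq> 0" "D \<noteq> 0"
    using assms by (simp_all add: d_def S_def S_par_def A_def B_def C_def D_def)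
  have e: "e 0 = d\<^sup>2 / (A * B * C * D)" "e 1 = p1 * p3 * S / (A * B * D)"
    "e 2 = p2 * p4 * S / (A * C * D)"
    by (simp_all add: e_def eta_t_def nu_def d_def S_def A_def B_def C_def D_def)
  have pars: "1 - t = d / (p1 * S)" "1 - u = - d / (p3 * S)" "1 - v = - d / (p2 * S)"
    "1 - w = d / (p4 * S)"
    using one_minus_pars[of p1 p2 p3 p4] assms(1-4) nz(2)
    by (simp_all add: t_def u_def v_def w_def d_def S_def)
  have "e 0 + e 1 * (1 - t) + e 2 * (1 - v) = d * (d + p3 * C - p4 * B) / (A * B * C * D)"
    unfolding e pars using nz assms(1-4) by (simp add: field_simps power2_eq_square)
  also have "d + p3 * C - p4 * B = 0"
    by (simp add: d_def B_def C_def algebra_simps)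
  finally show "e 0 + e 1 * (1 - t) + e 2 * (1 - v) = 0" by simp
  have "e 0 + e 1 * (1 - u) + e 2 * (1 - w) = d * (d - p1 * C + p2 * B) / (A * B * C * D)"
    unfolding e pars using nz assms(1-4) by (simp add: field_simps power2_eq_square)
  also have "d - p1 * C + p2 * B = 0"
    by (simp add: d_def B_def C_def algebra_simps)
  finally show "e 0 + e 1 * (1 - u) + e 2 * (1 - w) = 0" by simp
  have "e 0 + e 1 * (1 - t) * (1 - u) + e 2 * (1 - v) * (1 - w) =
      d\<^sup>2 * (S - C - B) / (A * B * C * D * S)"
    unfolding e pars using nz assms(1-4) by (simp add: field_simps power2_eq_square)
  also have "S - C - B = 0"
    by (simp add: S_def S_par_def B_def C_def)
  finally show "e 0 + e 1 * (1 - t) * (1 - u) + e 2 * (1 - v) * (1 - w) = 0" by simp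
qed

lemma form_monomial3_tilde:
  fixes p1 p2 p3 p4 :: complex
  assumes "p1 \<noteq> 0" "p2 \<noteq> 0" "p3 \<noteq> 0" "p4 \<noteq> 0"
    and "p1 + p2 \<noteq> 0" "p1 + p3 \<noteq> 0" "p2 + p4 \<noteq> 0" "p3 + p4 \<noteq> 0"
    and "p1 + p2 + p3 + p4 \<noteq> 0" "p1 * p4 - p2 * p3 \<noteq> 0"
    and "k \<noteq> m"
  shows "form p1 p2 p3 p4 N
     (monomial3 (x_t p1 p2 p3 p4) (y_t p1 p2 p3 p4) (z_t p1 p2 p3 p4) k)
     (monomial3 (x_t p1 p2 p3 p4) (y_t p1 p2 p3 p4) (z_t p1 p2 p3 p4) m) = 0"
proof -
  let ?e = "eta_t p1 p2 p3 p4" and ?h = "theta_t p1 p2 p3 p4"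
  \<comment> \<open>After weights and \<open>theta_t\<close> are split off, \<open>b\<close> and
    \<open>c\<close> are the coefficient vectors of \<open>y_t\<close> and \<open>z_t\<close>; that
    of \<open>x_t\<close> is constantly 1.\<close>
  define b where "b i = (if i = 0 then 1 else if i = 1 then 1 - t_par p1 p2 p3 p4
    else 1 - v_par p1 p2 p3 p4)" for i :: 3
  define c where "c i = (if i = 0 then 1 else if i = 1 then 1 - u_par p1 p2 p3 p4
    else 1 - w_par p1 p2 p3 p4)" for i :: 3
  have xyz: "x_t p1 p2 p3 p4 = lin (\<lambda>i. ?e i * ?h)"
    "y_t p1 p2 p3 p4 = lin (\<lambda>i. ?e i * (?h * b i))"
    "z_t p1 p2 p3 p4 = lin (\<lambda>i. ?e i * (?h * c i))"
    by (simp_all add: Const_1 x_t_def y_t_def z_t_def lin_def sum_UNIV_3 b_def c_def distrib_left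
        ac_simps flip: Const_mult)
  note orth = tilde_orthogonality[OF assms(1-10)]
  \<comment> \<open>The common factor \<open>theta_t\<close> is absorbed into the vectors, so every
    pairing is only multiplied by its square.\<close>
  have scale: "(\<Sum>i\<in>UNIV. ?e i * (?h * a i) * (?h * a' i)) = ?h\<^sup>2 * (\<Sum>i\<in>UNIV. ?e i * a i * a' i)"
    for a a' :: "3 \<Rightarrow> complex"
    by (simp add: sum_distrib_left power2_eq_square ac_simps)
  show ?thesis
    unfolding xyz
  proof (rule form_monomial3_lin[OF eta_t_nonzero[OF assms(1-10)]])
    show "(\<Sum>i\<in>UNIV. ?e i * ?h * (?h * b i)) = 0"
      using scale[of "\<lambda>_. 1" b] orth(1) by (simp add: sum_UNIV_3 b_def)
    show "(\<Sum>i\<in>UNIV. ?e i * ?h * (?h * c i)) = 0"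
      using scale[of "\<lambda>_. 1" c] orth(2) by (simp add: sum_UNIV_3 c_def)
    show "(\<Sum>i\<in>UNIV. ?e i * (?h * b i) * (?h * c i)) = 0"
      using scale[of b c] orth(3) by (simp add: sum_UNIV_3 b_def c_def)
  qed (rule \<open>k \<noteq> m\<close>)
qed

theorem mainTheorem7:
  fixes p1 p2 p3 p4 :: complex and N :: nat
  assumes "p1 \<noteq> 0" "p2 \<noteq> 0" "p3 \<noteq> 0" "p4 \<noteq> 0"
    and "p1 + p2 \<noteq> 0" "p1 + p3 \<noteq> 0" "p2 + p4 \<noteq> 0" "p3 + p4 \<noteq> 0"
    and "p1 + p2 + p3 + p4 \<noteq> 0"
    and "p1 * p4 - p2 * p3 \<noteq> 0"
  shows "nondegenerate_on (homogeneous N) (form p1 p2 p3 p4 N) \<and>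
    (\<forall>\<beta>\<in>sl3. \<forall>\<xi>\<in>homogeneous N. \<forall>\<zeta>\<in>homogeneous N.
       form p1 p2 p3 p4 N (act \<beta> \<xi>) \<zeta> =
       form p1 p2 p3 p4 N \<xi> (act (dagger p1 p2 p3 p4 \<beta>) \<zeta>)) \<and>
    (\<forall>l\<in>index_triples N. \<forall>m\<in>index_triples N. l \<noteq> m \<longrightarrow>
       (\<forall>\<xi>\<in>wt_space l. \<forall>\<zeta>\<in>wt_space m. form p1 p2 p3 p4 N \<xi> \<zeta> = 0) \<and>
       (\<forall>\<xi>\<in>wt_space_t p1 p2 p3 p4 l. \<forall>\<zeta>\<in>wt_space_t p1 p2 p3 p4 m.
          form p1 p2 p3 p4 N \<xi> \<zeta> = 0))"
proof (intro conjI ballI impI)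
  note eta = eta_t_nonzero[OF assms]
  have "theta p1 p2 p3 p4 \<noteq> 0"
    using assms by (auto simp: theta_def)
  then show "nondegenerate_on (homogeneous N) (form p1 p2 p3 p4 N)"
    by (rule nondegenerate_form[OF eta])
  show "form p1 p2 p3 p4 N (act \<beta> \<xi>) \<zeta> = form p1 p2 p3 p4 N \<xi> (act (dagger p1 p2 p3 p4 \<beta>) \<zeta>)"
    for \<beta> \<xi> \<zeta>
    by (rule form_act[OF eta])
  fix l m :: "nat \<times> nat \<times> nat" assume "l \<noteq> m"
  show "form p1 p2 p3 p4 N \<xi> \<zeta> = 0" if "\<xi> \<in> wt_space l" "\<zeta> \<in> wt_space m" for \<xi> \<zeta>
    using form_line_zero[OF form_monomial_orthogonal[OF \<open>l \<noteq> m\<close>]] that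
    unfolding wt_space_def by blast
  show "form p1 p2 p3 p4 N \<xi> \<zeta> = 0"
    if "\<xi> \<in> wt_space_t p1 p2 p3 p4 l" "\<zeta> \<in> wt_space_t p1 p2 p3 p4 m" for \<xi> \<zeta>
    using form_line_zero[OF form_monomial3_tilde[OF assms \<open>l \<noteq> m\<close>]] that
    unfolding wt_space_t_def by blast
qed

end
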